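(* For any $\lambda>0$, let $(X_\lambda,Y_\lambda)\in\mathbb{R}^2$ be the (unique) solution of the system $$\lambda u_1+B_1(u_1,u_2)=0,\qquad \lambda u_2+B_2(u_1,u_2)=0 ,$$ where $B_1,B_2:\mathbb{R}^2\to\mathbb{R}$ are the functions defined in the context. Then: (i) The set of points $(X_\lambda,Y_\lambda)$, with $\lambda>0$, is bounded in $\mathbb{R}^2$. (ii) We have $$\liminf_{\lambda\to0+}X_\lambda\le \frac d2<\limsup_{\lambda\to0+}X_\lambda\quad\text{and}\quad \liminf_{\lambda\to0+}Y_\lambda\le-\frac d2<\limsup_{\lambda\to0+}Y_\lambda .$$ In particular, the family of the pairs $(X_\lambda,Y_\lambda)$ does not converge as $\lambda\to0+$.
   Context: Fix a real number $d>1$, set $\gamma=\frac{d}{1+d}$, and choose $K\in\mathbb{N}$ (a positive integer) such that $\gamma+4^{-K}<1$. Let $$\mathcal{A}=\{\gamma+4^{-k} : k\in\mathbb{N},\ k\ge K\}\cup\{\gamma\},\qquad \mathcal{B}=\{0,1\}.$$ For $\alpha,\beta\in\mathbb{R}$ set $$c_{11}(\alpha,\beta)=c_{22}(\alpha,\beta)=\alpha+\beta-2\alpha\beta,\qquad c_{12}(\alpha,\beta)=c_{21}(\alpha,\beta)=-(\alpha+\beta-2\alpha\beta),$$ $$L_1(\alpha,\beta)=\alpha\beta+d^2(1-\alpha)(1-\beta),\qquad L_2(\alpha,\beta)=-\alpha\beta-d^2(1-\alpha)(1-\beta).$$ For $i\in\{1,2\}$ the continuous function $B_i:\mathbb{R}^2\to\mathbb{R}$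 is $$B_i(u_1,u_2)=\max_{\alpha\in\mathcal{A}}\ \min_{\beta\in\mathcal{B}}\bigl(c_{i1}(\alpha,\beta)u_1+c_{i2}(\alpha,\beta)u_2-L_i(\alpha,\beta)\bigr).$$ For every $\lambda>0$ the system $\lambda u_i+B_i(u_1,u_2)=0$, $i=1,2$, has a unique solution $(u_1,u_2)\in\mathbb{R}^2$. *)

theory Defs
  imports "HOL-Analysis.Analysis"
begin

definition gam :: "real \<Rightarrow> real"
  where "gam d = d / (1 + d)"

definition ctrlA :: "real \<Rightarrow> nat \<Rightarrow> real set"
  where "ctrlA d K = {gam d + 1 / 4 ^ k | k. k \<ge> K} \<union> {gam d}"

definition ctrlB :: "real set"
  where "ctrlB = {0, 1}"

definition c :: "nat \<Rightarrow> nat \<Rightarrow> real \<Rightarrow> real \<Rightarrow> real"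
  where "c i j \<alpha> \<beta> =
    (if i = j then \<alpha> + \<beta> - 2 * \<alpha> * \<beta> else - (\<alpha> + \<beta> - 2 * \<alpha> * \<beta>))"

definition L :: "real \<Rightarrow> nat \<Rightarrow> real \<Rightarrow> real \<Rightarrow> real"
  where "L d i \<alpha> \<beta> =
    (if i = 1 then \<alpha> * \<beta> + d\<^sup>2 * (1 - \<alpha>) * (1 - \<beta>)
     else - \<alpha> * \<beta> - d\<^sup>2 * (1 - \<alpha>) * (1 - \<beta>))"

definition minB :: "real \<Rightarrow> nat \<Rightarrow> real \<Rightarrow> real \<Rightarrow> real \<Rightarrow> real"
  where "minB d i u1 u2 \<alpha> =
    (MIN \<beta>\<in>ctrlB. c i 1 \<alpha> \<beta> * u1 + c i 2 \<alpha> \<beta> * u2 - L d i \<alpha> \<beta>)"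

text \<open>
  \<open>ctrlA d K\<close> is infinite, so \<open>Max\<close> does not apply to it; the maximum over it is written as a
  supremum. It is attained: see \<open>B_attained\<close>. The indices \<open>i, j\<close> are meant to range over \<open>{1, 2}\<close>.
\<close>

definition B :: "real \<Rightarrow> nat \<Rightarrow> nat \<Rightarrow> real \<Rightarrow> real \<Rightarrow> real"
  where "B d K i u1 u2 = (SUP \<alpha>\<in>ctrlA d K. minB d i u1 u2 \<alpha>)"

lemma minB_eq:
  "minB d i u1 u2 \<alpha> =
    min (c i 1 \<alpha> 0 * u1 + c i 2 \<alpha> 0 * u2 - L d i \<alpha> 0)
        (c i 1 \<alpha> 1 * u1 + c i 2 \<alpha> 1 * u2 - L d i \<alpha> 1)"
  by (simp add: minB_def ctrlB_def)

lemma compact_ctrlA: "compact (ctrlA d K)"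
proof -
  have "(\<lambda>n. gam d + (1/4) ^ (n + K)) \<longlonglongrightarrow> gam d + 0"
    by (intro tendsto_add tendsto_const LIMSEQ_ignore_initial_segment LIMSEQ_power_zero) simp
  then have "compact (insert (gam d) (range (\<lambda>n. gam d + (1/4) ^ (n + K))))"
    by (intro compact_sequence_with_limit) simp
  moreover have "range (\<lambda>n. gam d + (1/4) ^ (n + K)) = {gam d + 1 / 4 ^ k | k. k \<ge> K}"
  proof (intro set_eqI iffI)
    fix x assume "x \<in> {gam d + 1 / 4 ^ k | k. k \<ge> K}"
    then obtain k where "k \<ge> K" "x = gam d + 1 / 4 ^ k" by auto
    then have "x = gam d + (1/4) ^ ((k - K) + K)" by (simp add: power_divide)
    then show "x \<in> range (\<lambda>n. gam d + (1/4) ^ (n + K))" by blast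
  next
    fix x assume "x \<in> range (\<lambda>n. gam d + (1/4) ^ (n + K))"
    then obtain n where "x = gam d + (1/4) ^ (n + K)" by blast
    then have "x = gam d + 1 / 4 ^ (n + K) \<and> K \<le> n + K" by (simp add: power_divide)
    then show "x \<in> {gam d + 1 / 4 ^ k | k. k \<ge> K}" by blast
  qed
  ultimately show ?thesis by (simp add: ctrlA_def)
qed

lemma B_attained:
  "\<exists>\<alpha>\<in>ctrlA d K. B d K i u1 u2 = minB d i u1 u2 \<alpha> \<and>
     (\<forall>\<alpha>'\<in>ctrlA d K. minB d i u1 u2 \<alpha>' \<le> minB d i u1 u2 \<alpha>)"
proof -
  have "continuous_on (ctrlA d K) (minB d i u1 u2)"
    unfolding minB_eq c_def L_def
    by (cases "i = 1"; cases "i = 2"; simp; intro continuous_intros)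
  then obtain \<alpha> where \<alpha>: "\<alpha> \<in> ctrlA d K"
      "\<forall>\<alpha>'\<in>ctrlA d K. minB d i u1 u2 \<alpha>' \<le> minB d i u1 u2 \<alpha>"
    using continuous_attains_sup[OF compact_ctrlA, of d K "minB d i u1 u2"]
    by (auto simp: ctrlA_def)
  then have "B d K i u1 u2 = minB d i u1 u2 \<alpha>"
    unfolding B_def by (intro cSup_eq_maximum) auto
  with \<alpha> show ?thesis by blast
qed

lemma ctrlA_bounds:
  assumes "d > 1" "gam d + 1 / 4 ^ K < 1" "\<alpha> \<in> ctrlA d K"
  shows "0 \<le> \<alpha>" "\<alpha> \<le> 1"
proof -
  have g: "0 \<le> gam d" "gam d \<le> 1" using assms(1) by (auto simp: gam_def)
  have "1 / 4 ^ k \<le> 1 / (4::real) ^ K" if "k \<ge> K" for k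
    using that by (intro divide_left_mono power_increasing) auto
  moreover have "0 \<le> 1 / (4::real) ^ k" for k by simp
  ultimately have "gam d + 1 / 4 ^ k \<le> 1 \<and> 0 \<le> gam d + 1 / 4 ^ k" if "k \<ge> K" for k
    using that assms(2) g(1) by (smt (verit))
  then show "0 \<le> \<alpha>" "\<alpha> \<le> 1" using assms(3) g by (auto simp: ctrlA_def)
qed

lemma B_shift:
  assumes dK: "d > 1" "gam d + 1 / 4 ^ K < 1" and le: "u1 - u2 \<le> v1 - v2"
  shows "B d K 1 u1 u2 \<le> B d K 1 v1 v2"
    and "B d K 1 v1 v2 \<le> B d K 1 u1 u2 + ((v1 - v2) - (u1 - u2))"
    and "B d K 2 v1 v2 \<le> B d K 2 u1 u2"
    and "B d K 2 u1 u2 \<le> B d K 2 v1 v2 + ((v1 - v2) - (u1 - u2))"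
proof -
  have m1: "minB d 1 x y \<alpha> = min (\<alpha> * (x - y) - d\<^sup>2 * (1 - \<alpha>)) ((1 - \<alpha>) * (x - y) - \<alpha>)"
    and m2: "minB d 2 x y \<alpha> = min (d\<^sup>2 * (1 - \<alpha>) - \<alpha> * (x - y)) (\<alpha> - (1 - \<alpha>) * (x - y))"
    for x y \<alpha> by (simp_all add: minB_eq c_def L_def algebra_simps)
  have s: "0 \<le> \<alpha> * (v1 - v2) - \<alpha> * (u1 - u2)"
      "\<alpha> * (v1 - v2) - \<alpha> * (u1 - u2) \<le> (v1 - v2) - (u1 - u2)" if "0 \<le> \<alpha>" "\<alpha> \<le> 1" for \<alpha>
    using mult_left_mono[OF le, of \<alpha>] mult_left_mono[OF le, of "1 - \<alpha>"] that
    by (auto simp: algebra_simps)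
  have *: "minB d 1 u1 u2 \<alpha> \<le> minB d 1 v1 v2 \<alpha>"
      "minB d 1 v1 v2 \<alpha> \<le> minB d 1 u1 u2 \<alpha> + ((v1 - v2) - (u1 - u2))"
      "minB d 2 v1 v2 \<alpha> \<le> minB d 2 u1 u2 \<alpha>"
      "minB d 2 u1 u2 \<alpha> \<le> minB d 2 v1 v2 \<alpha> + ((v1 - v2) - (u1 - u2))"
    if "\<alpha> \<in> ctrlA d K" for \<alpha>
    using s[of \<alpha>] s[of "1 - \<alpha>"] ctrlA_bounds[OF dK that] unfolding m1 m2 by linarith+
  have att: "\<exists>\<alpha>\<in>ctrlA d K. B d K i x y = minB d i x y \<alpha>" for i x y
    using B_attained by blast
  have ge: "minB d i x y \<alpha> \<le> B d K i x y" if "\<alpha> \<in> ctrlA d K" for i x y \<alpha>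
    using B_attained[of d K i x y] that by auto
  show "B d K 1 u1 u2 \<le> B d K 1 v1 v2"
    using att[of 1 u1 u2] *(1) ge by (metis order_trans)
  show "B d K 1 v1 v2 \<le> B d K 1 u1 u2 + ((v1 - v2) - (u1 - u2))"
    using att[of 1 v1 v2] *(2) ge by (smt (verit))
  show "B d K 2 v1 v2 \<le> B d K 2 u1 u2"
    using att[of 2 v1 v2] *(3) ge by (metis order_trans)
  show "B d K 2 u1 u2 \<le> B d K 2 v1 v2 + ((v1 - v2) - (u1 - u2))"
    using att[of 2 u1 u2] *(4) ge by (smt (verit))
qed

lemma system_unique_solution:
  assumes dK: "d > 1" "gam d + 1 / 4 ^ K < 1" and lam: "lam > 0"
  shows "\<exists>!(u1, u2). lam * u1 + B d K 1 u1 u2 = 0 \<and> lam * u2 + B d K 2 u1 u2 = 0"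
proof -
  note sh = B_shift[OF dK]
  have dep: "B d K 1 x y = B d K 1 (x - y) 0" "B d K 2 x y = B d K 2 (x - y) 0" for x y
    using sh[of x y "x - y" 0] by auto
  define g where "g D = B d K 1 D 0 - B d K 2 D 0" for D
  have mono: "g D \<le> g E" and lip: "g E \<le> g D + 2 * (E - D)" if "D \<le> E" for D E
    using sh[of D 0 E 0] that unfolding g_def by auto
  have "\<bar>g E - g D\<bar> \<le> 2 * \<bar>E - D\<bar>" for D E
    using mono[of D E] lip[of D E] mono[of E D] lip[of E D] by (cases "D \<le> E") auto
  then have "2-lipschitz_on UNIV g"
    by (intro lipschitz_onI) (auto simp: dist_real_def)
  then have cont: "continuous_on UNIV g" by (rule lipschitz_on_continuous_on)
  define M where "M = \<bar>g 0\<bar> / lam"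
  have "lam * M = \<bar>g 0\<bar>" "M \<ge> 0" using lam by (auto simp: M_def)
  have "\<exists>D. - M \<le> D \<and> D \<le> M \<and> lam * D + g D = 0"
  proof (rule IVT')
    show "lam * (- M) + g (- M) \<le> 0"
      using mono[of "- M" 0] \<open>lam * M = _\<close> \<open>M \<ge> 0\<close> by auto
    show "0 \<le> lam * M + g M"
      using mono[of 0 M] \<open>lam * M = _\<close> \<open>M \<ge> 0\<close> by auto
    show "- M \<le> M" using \<open>M \<ge> 0\<close> by simp
    show "continuous_on {- M..M} (\<lambda>D. lam * D + g D)"
      by (intro continuous_intros continuous_on_subset[OF cont]) auto
  qed
  then obtain D where D: "lam * D + g D = 0" by blast
  have uniq: "E = D" if "lam * E + g E = 0" for E
    using that D mono[of D E] mono[of E D] mult_strict_left_mono[OF _ lam, of D E]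
      mult_strict_left_mono[OF _ lam, of E D] by (cases "D < E"; cases "E < D") auto
  have iff: "lam * u1 + B d K 1 u1 u2 = 0 \<and> lam * u2 + B d K 2 u1 u2 = 0 \<longleftrightarrow>
      u1 = - B d K 1 D 0 / lam \<and> u2 = - B d K 2 D 0 / lam" for u1 u2
  proof
    assume s: "lam * u1 + B d K 1 u1 u2 = 0 \<and> lam * u2 + B d K 2 u1 u2 = 0"
    then have "lam * (u1 - u2) + g (u1 - u2) = 0"
      using dep[of u1 u2] by (simp add: g_def algebra_simps)
    then have "u1 - u2 = D" by (rule uniq)
    with s dep[of u1 u2] lam
    show "u1 = - B d K 1 D 0 / lam \<and> u2 = - B d K 2 D 0 / lam"
      by (simp add: field_simps)
  next
    assume s: "u1 = - B d K 1 D 0 / lam \<and> u2 = - B d K 2 D 0 / lam"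
    then have "lam * (u1 - u2) = lam * D"
      using lam D by (simp add: g_def field_simps)
    then have "u1 - u2 = D" using lam by simp
    with s dep[of u1 u2] lam
    show "lam * u1 + B d K 1 u1 u2 = 0 \<and> lam * u2 + B d K 2 u1 u2 = 0"
      by (simp add: field_simps)
  qed
  show ?thesis unfolding iff by auto
qed

end

theory Submission
  imports Defs
begin

text \<open>
  Both \<open>B\<^sub>1\<close> and \<open>B\<^sub>2\<close> depend only on \<open>D = u\<^sub>1 - u\<^sub>2\<close>; the first is increasing in \<open>D\<close>, the second
  decreasing, and both vanish at \<open>D = d\<close>. Hence solutions of the system correspond to
  \<open>D \<in> (0, d)\<close> through \<open>\<lambda> D = B\<^sub>2 D - B\<^sub>1 D\<close>, and \<open>\<lambda> \<rightarrow> 0\<close> as \<open>D \<rightarrow> d\<close>. Moreover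
  \<open>X - D/2 = Y + D/2 = - (B\<^sub>1 D + B\<^sub>2 D) / (2 \<lambda>)\<close>, so everything is decided by the sign and size of
  \<open>B\<^sub>1 D + B\<^sub>2 D\<close>. With all of \<open>[0, 1]\<close> as controls, this sum would vanish, the optimal \<open>\<alpha>\<close> being
  the one that makes the two terms of the minimum equal; that \<open>\<alpha>\<close> tends to \<open>\<gamma>\<close> from above as
  \<open>D\<close> increases to \<open>d\<close>. If it equals some \<open>\<gamma> + 4\<^sup>-\<^sup>k\<close>, the sum is nonnegative; if it sits well
  inside a gap of the control set, the sum is at most a negative multiple of \<open>d - D\<close>,
  which is the order of magnitude of \<open>\<lambda>\<close>.
\<close>

section \<open>Lower and upper limits along a subfamily\<close>

text \<open>What holds eventually in \<open>F\<close> holds eventually along \<open>s\<close>, so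
  sampling can only raise the lower limit; one well-chosen sequence thus bounds it from
  above.\<close>

lemma Liminf_le_tendsto_along:
  fixes f :: "'a \<Rightarrow> 'b :: {complete_linorder, linorder_topology}"
  assumes s: "filterlim s F G" and G: "G \<noteq> bot"
    and le: "\<forall>\<^sub>F n in G. f (s n) \<le> g n" and g: "(g \<longlongrightarrow> l) G"
  shows "Liminf F f \<le> l"
proof -
  have "Liminf F f \<le> Liminf G g"
    unfolding le_Liminf_iff
  proof (intro allI impI)
    fix y assume "y < Liminf F f"
    then have "\<forall>\<^sub>F x in F. y < f x" by (rule less_LiminfD)
    then have "\<forall>\<^sub>F n in G. y < f (s n)" using s by (rule eventually_compose_filterlim)
    with le show "\<forall>\<^sub>F n in G. y < g n" by eventually_elim auto
  qed
  with lim_imp_Liminf[OF G g] show ?thesis by simp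
qed

lemma Limsup_ge_tendsto_along:
  fixes f :: "'a \<Rightarrow> 'b :: {complete_linorder, linorder_topology}"
  assumes s: "filterlim s F G" and G: "G \<noteq> bot"
    and le: "\<forall>\<^sub>F n in G. g n \<le> f (s n)" and g: "(g \<longlongrightarrow> l) G"
  shows "l \<le> Limsup F f"
proof -
  have "Limsup G g \<le> Limsup F f"
    unfolding Limsup_le_iff
  proof (intro allI impI)
    fix y assume "Limsup F f < y"
    then have "\<forall>\<^sub>F x in F. f x < y" by (rule Limsup_lessD)
    then have "\<forall>\<^sub>F n in G. f (s n) < y" using s by (rule eventually_compose_filterlim)
    with le show "\<forall>\<^sub>F n in G. g n < y" by eventually_elim auto
  qed
  with lim_imp_Limsup[OF G g] show ?thesis by simp
qed

section \<open>Control set and Hamiltonians as functions of \<open>D\<close>\<close>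

locale hamiltonian =
  fixes d :: real and K :: nat
  assumes d_gt_1: "d > 1" and gam_K: "gam d + 1 / 4 ^ K < 1"
begin

lemma gam_eq: "gam d * (1 + d) = d"
  using d_gt_1 by (simp add: gam_def)

lemma gam_eq_square: "gam d * (d + d\<^sup>2) = d\<^sup>2"
  using arg_cong[OF gam_eq, of "\<lambda>x. x * d"] by (simp add: algebra_simps power2_eq_square)

lemma gam_gt_half: "gam d > 1 / 2"
  using d_gt_1 by (simp add: gam_def field_simps)

lemma gam_lt_1: "gam d < 1"
  using d_gt_1 by (simp add: gam_def field_simps)

lemma gam_mem: "gam d \<in> ctrlA d K"
  by (simp add: ctrlA_def)

lemma ctrlA_ge_gam: "\<alpha> \<in> ctrlA d K \<Longrightarrow> gam d \<le> \<alpha>"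
  by (auto simp: ctrlA_def)

lemma ctrlA_gap:
  assumes "\<alpha> \<in> ctrlA d K"
  shows "\<alpha> \<le> gam d + (1 / 4) ^ Suc k \<or> gam d + (1 / 4) ^ k \<le> \<alpha>"
proof -
  have "(1 / 4 :: real) ^ j \<le> (1 / 4) ^ Suc k \<or> (1 / 4 :: real) ^ k \<le> (1 / 4) ^ j" for j
    by (cases "j \<le> k") (intro disjI2 disjI1 power_decreasing; simp)+
  moreover have "\<alpha> = gam d \<or> (\<exists>j. \<alpha> = gam d + (1 / 4) ^ j)"
    using assms by (auto simp: ctrlA_def power_divide)
  ultimately show ?thesis by fastforce
qed

text \<open>The terms for \<open>i = 2\<close> are the negatives of those for \<open>i = 1\<close>,
  so for a single \<open>\<alpha>\<close> the two minima add up to minus the distance between the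
  terms.\<close>

lemma minB_1: "minB d 1 x y \<alpha> = min (\<alpha> * (x - y + d\<^sup>2) - d\<^sup>2) (x - y - \<alpha> * (x - y + 1))"
  and minB_2: "minB d 2 x y \<alpha> = min (d\<^sup>2 - \<alpha> * (x - y + d\<^sup>2)) (\<alpha> * (x - y + 1) - (x - y))"
  by (simp_all add: minB_eq c_def L_def algebra_simps)

lemma minB_le_B: "\<alpha> \<in> ctrlA d K \<Longrightarrow> minB d i x y \<alpha> \<le> B d K i x y"
  using B_attained by metis

lemma B_leI: "(\<And>\<alpha>. \<alpha> \<in> ctrlA d K \<Longrightarrow> minB d i x y \<alpha> \<le> b) \<Longrightarrow> B d K i x y \<le> b"
  using B_attained by metis

lemma B_diff: "B d K 1 x y = B d K 1 (x - y) 0" "B d K 2 x y = B d K 2 (x - y) 0"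
  using B_shift[OF d_gt_1 gam_K, of x y "x - y" 0] by auto

lemma B_1_mono: "D \<le> E \<Longrightarrow> B d K 1 D 0 \<le> B d K 1 E 0"
  and B_1_lipschitz: "D \<le> E \<Longrightarrow> B d K 1 E 0 \<le> B d K 1 D 0 + (E - D)"
  and B_2_antimono: "D \<le> E \<Longrightarrow> B d K 2 E 0 \<le> B d K 2 D 0"
  and B_2_lipschitz: "D \<le> E \<Longrightarrow> B d K 2 D 0 \<le> B d K 2 E 0 + (E - D)"
  using B_shift[OF d_gt_1 gam_K, of D 0 E 0] by auto

text \<open>At \<open>D = d\<close> the control \<open>gam d\<close> makes both terms vanish; every
  other control is larger, which pushes the term decreasing in \<open>\<alpha>\<close> below
  0.\<close>

lemma B_1_at_d: "B d K 1 d 0 = 0"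
proof (rule antisym)
  show "B d K 1 d 0 \<le> 0"
  proof (rule B_leI)
    fix \<alpha> assume "\<alpha> \<in> ctrlA d K"
    then have "gam d * (1 + d) \<le> \<alpha> * (1 + d)"
      using ctrlA_ge_gam d_gt_1 by (intro mult_right_mono) auto
    then have "d - 0 - \<alpha> * (d - 0 + 1) \<le> 0" by (simp add: gam_eq add.commute)
    then show "minB d 1 d 0 \<alpha> \<le> 0" unfolding minB_1 by (rule min.coboundedI2)
  qed
  show "0 \<le> B d K 1 d 0"
    using minB_le_B[OF gam_mem, of 1 d 0] gam_eq gam_eq_square
    unfolding minB_1 by (simp add: add.commute)
qed

lemma B_2_at_d: "B d K 2 d 0 = 0"
proof (rule antisym)
  show "B d K 2 d 0 \<le> 0"
  proof (rule B_leI)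
    fix \<alpha> assume "\<alpha> \<in> ctrlA d K"
    then have "gam d * (d + d\<^sup>2) \<le> \<alpha> * (d + d\<^sup>2)"
      using ctrlA_ge_gam d_gt_1 by (intro mult_right_mono) auto
    then show "minB d 2 d 0 \<alpha> \<le> 0" using gam_eq_square by (simp add: minB_2)
  qed
  show "0 \<le> B d K 2 d 0"
    using minB_le_B[OF gam_mem, of 2 d 0] gam_eq gam_eq_square by (simp add: minB_2 add.commute)
qed

lemma B_1_nonpos: "D \<le> d \<Longrightarrow> B d K 1 D 0 \<le> 0"
  using B_1_mono B_1_at_d by metis

lemma B_2_pos:
  assumes "D < d" shows "0 < B d K 2 D 0"
proof -
  \<comment> \<open>For the control \<open>gam d\<close> both terms are affine in \<open>D\<close>
    and vanish at \<open>D = d\<close>, hence are multiples of \<open>d - D\<close>.\<close>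
  have "d\<^sup>2 - gam d * (D + d\<^sup>2) = gam d * (d - D)"
       "gam d * (D + 1) - D = (1 - gam d) * (d - D)"
    using gam_eq gam_eq_square by (simp_all add: algebra_simps)
  then have "0 < minB d 2 D 0 (gam d)"
    using assms gam_gt_half gam_lt_1 by (simp add: minB_2)
  then show ?thesis using minB_le_B[OF gam_mem] by (rule less_le_trans)
qed

section \<open>Sum of the two Hamiltonians: at balanced points and inside gaps\<close>

text \<open>The value of \<open>D\<close> at which both terms of the minimum agree for \<open>\<alpha> = \<gamma> + \<eta>\<close>.\<close>

definition balanced :: "real \<Rightarrow> real"
  where "balanced \<eta> = d - \<eta> * (1 + d)\<^sup>2 / (2 * gam d - 1 + 2 * \<eta>)"

lemma balanced_eq:
  assumes "\<eta> \<ge> 0"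
  shows "(gam d + \<eta>) * (balanced \<eta> + d\<^sup>2) - d\<^sup>2 = balanced \<eta> - (gam d + \<eta>) * (balanced \<eta> + 1)"
proof -
  \<comment> \<open>\<open>gam d > 1 / 2\<close> keeps the denominator positive; the claim is this
    linear equation once \<open>gam d * (1 + d) = d\<close> is used.\<close>
  have "(2 * gam d - 1 + 2 * \<eta>) * balanced \<eta> = (2 * gam d - 1 + 2 * \<eta>) * d - \<eta> * (1 + d)\<^sup>2"
    using assms gam_gt_half by (simp add: balanced_def field_simps)
  then show ?thesis using gam_eq by algebra
qed

text \<open>When the two terms agree, their common value cancels between the minima for
  \<open>i = 1\<close> and \<open>i = 2\<close>; admissibility of this control turns that into a
  lower bound for the sum of the suprema.\<close>

lemma B_sum_nonneg_balanced:
  assumes "gam d + \<eta> \<in> ctrlA d K" "\<eta> \<ge> 0"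
  shows "0 \<le> B d K 1 (balanced \<eta>) 0 + B d K 2 (balanced \<eta>) 0"
  using minB_le_B[OF assms(1), of 1 "balanced \<eta>" 0] minB_le_B[OF assms(1), of 2 "balanced \<eta>" 0]
    balanced_eq[OF assms(2)]
  unfolding minB_1 minB_2 by simp

text \<open>
  To first order in \<open>h\<close>, the two terms of the minimum agree for \<open>\<alpha> = \<gamma> + 2 h\<close> when
  \<open>D = d - h t\<close> with this \<open>t\<close>.
\<close>

definition slope :: real
  where "slope = 2 * (1 + d) ^ 3 / (d - 1)"

lemma slope_pos: "slope > 0"
  using d_gt_1 by (simp add: slope_def)

text \<open>No control lies strictly between \<open>gam d + h\<close> and
  \<open>gam d + 4 * h\<close>, while the terms would balance near \<open>gam d + 2 * h\<close>.
  Each supremum is therefore bounded by values at the two ends of the gap; the loss is of first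
  order in \<open>h\<close>, the correction of second order.\<close>

lemma B_sum_gap:
  fixes k defines "h \<equiv> (1 / 4) ^ Suc k"
  assumes D: "0 < d - h * slope"
  shows "B d K 1 (d - h * slope) 0 + B d K 2 (d - h * slope) 0 \<le> - (1 + d - 8 * (h * slope)) * h"
proof -
  define e where "e = h * slope"
  \<comment> \<open>This unit turns \<open>h * (1 + d)\<close> and \<open>e\<close> into
    \<open>q\<close> times polynomials in \<open>d\<close>, so that the first-order comparisons
    below contain no division.\<close>
  define q where "q = h * (1 + d) / (d - 1)"
  have h: "h > 0" by (simp add: h_def)
  have gap: "\<alpha> \<le> gam d + h \<or> gam d + 4 * h \<le> \<alpha>" if "\<alpha> \<in> ctrlA d K" for \<alpha>
    using ctrlA_gap[OF that, of k] by (simp add: h_def)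
  have hq: "h * (1 + d) = q * (d - 1)" and eq: "e = 2 * q * (1 + d)\<^sup>2"
    using d_gt_1 by (simp_all add: q_def e_def slope_def power2_eq_square power3_eq_cube)
  have q: "q > 0" using h d_gt_1 by (simp add: q_def)
  have e: "e > 0" using h slope_pos by (simp add: e_def)
  have pos: "d - e + d\<^sup>2 \<ge> 0" "d - e + 1 \<ge> 0"
    using D d_gt_1 by (auto simp: e_def less_imp_le)
  define f where "f \<alpha> = \<alpha> * (d - e + d\<^sup>2) - d\<^sup>2" for \<alpha>
  define g where "g \<alpha> = (d - e) - \<alpha> * (d - e + 1)" for \<alpha>
  have f_mono: "f \<alpha> \<le> f \<beta>" and g_anti: "g \<beta> \<le> g \<alpha>" if "\<alpha> \<le> \<beta>" for \<alpha> \<beta>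
    using mult_right_mono[OF that pos(1)] mult_right_mono[OF that pos(2)]
    by (simp_all add: f_def g_def)
  have m: "minB d 1 (d - e) 0 \<alpha> = min (f \<alpha>) (g \<alpha>)" "minB d 2 (d - e) 0 \<alpha> = min (- f \<alpha>) (- g \<alpha>)" for \<alpha>
    unfolding minB_1 minB_2 f_def g_def by simp_all
  \<comment> \<open>Left of the gap the increasing \<open>f\<close> is at most its value at the left
    end, right of it the decreasing \<open>g\<close> is at most its value at the right end; for
    \<open>i = 2\<close> the roles swap.\<close>
  have B1: "B d K 1 (d - e) 0 \<le> max (f (gam d + h)) (g (gam d + 4 * h))"
  proof (rule B_leI)
    fix \<alpha> assume "\<alpha> \<in> ctrlA d K"
    with gap f_mono g_anti have "f \<alpha> \<le> f (gam d + h) \<or> g \<alpha> \<le> g (gam d + 4 * h)" by blast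
    then show "minB d 1 (d - e) 0 \<alpha> \<le> max (f (gam d + h)) (g (gam d + 4 * h))"
      unfolding m by linarith
  qed
  have B2: "B d K 2 (d - e) 0 \<le> max (- g (gam d + h)) (- f (gam d + 4 * h))"
  proof (rule B_leI)
    fix \<alpha> assume "\<alpha> \<in> ctrlA d K"
    with gap f_mono g_anti have "g (gam d + h) \<le> g \<alpha> \<or> f (gam d + 4 * h) \<le> f \<alpha>" by blast
    then show "minB d 2 (d - e) 0 \<alpha> \<le> max (- g (gam d + h)) (- f (gam d + 4 * h))"
      unfolding m by linarith
  qed
  have ge: "gam d * e = 2 * q * (d * (1 + d))"
    using arg_cong[OF gam_eq, of "\<lambda>x. x * (2 * q * (1 + d))"]
    by (simp add: eq power2_eq_square mult_ac)
  have hqd: "d * (h * (1 + d)) = d * (q * (d - 1))" by (simp add: hq)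
  have fx: "f (gam d + x * h) = - (gam d * e) + x * (d * (h * (1 + d))) - x * (h * e)"
   and gx: "g (gam d + x * h) = - e + gam d * e - x * (h * (1 + d)) + x * (h * e)" for x
    using gam_eq gam_eq_square by (simp_all add: f_def g_def algebra_simps power2_eq_square)
  have f1: "f (gam d + h) = q * (- d\<^sup>2 - 3 * d) - h * e"
    using fx[of 1] unfolding ge hqd by (simp add: algebra_simps power2_eq_square)
  have f4: "f (gam d + 4 * h) = q * (2 * d\<^sup>2 - 6 * d) - 4 * (h * e)"
    unfolding fx ge hqd by (simp add: algebra_simps power2_eq_square)
  have g1: "g (gam d + h) = q * (- 3 * d - 1) + h * e"
    using gx[of 1] unfolding ge hq by (simp add: eq algebra_simps power2_eq_square)
  have g4: "g (gam d + 4 * h) = q * (2 - 6 * d) + 4 * (h * e)"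
    unfolding gx ge hq by (simp add: eq algebra_simps power2_eq_square)
  have he: "h * e > 0" using h e by simp
  have p: "0 \<le> q * (d - 1)" "0 \<le> q * (d * (d - 1))" "q * (d - 1) \<le> q * (d * (d - 1))"
    using q d_gt_1 by simp_all
  \<comment> \<open>The first-order parts of the four pairs formed by a bound for
    \<open>B d K 1\<close> and a bound for \<open>B d K 2\<close>.\<close>
  have "q * (- d\<^sup>2 - 3 * d) + q * (3 * d + 1) \<le> - (q * (d - 1))"
       "q * (- d\<^sup>2 - 3 * d) + q * (6 * d - 2 * d\<^sup>2) \<le> - (q * (d - 1))"
       "q * (2 - 6 * d) + q * (3 * d + 1) \<le> - (q * (d - 1))"
       "q * (2 - 6 * d) + q * (6 * d - 2 * d\<^sup>2) \<le> - (q * (d - 1))"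
    using p by (simp_all add: algebra_simps power2_eq_square)
  moreover have "- g (gam d + h) = q * (3 * d + 1) - h * e"
      "- f (gam d + 4 * h) = q * (6 * d - 2 * d\<^sup>2) + 4 * (h * e)"
    unfolding g1 f4 by (simp_all add: algebra_simps)
  \<comment> \<open>The factor 8 comes from the worst pair, \<open>g (gam d + 4 * h)\<close> with
    \<open>- f (gam d + 4 * h)\<close>, each contributing \<open>4 * (h * e)\<close>.\<close>
  ultimately have "B d K 1 (d - e) 0 + B d K 2 (d - e) 0 \<le> - (q * (d - 1)) + 8 * (h * e)"
    using B1 B2 he unfolding f1 g4 by linarith
  then show ?thesis unfolding hq[symmetric] by (simp add: e_def algebra_simps)
qed

section \<open>The discount as a function of the difference\<close>

text \<open>Parametrises the problem by \<open>D\<close> instead of \<open>lam\<close>: for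
  \<open>0 < D < d\<close> this is the \<open>lam\<close> whose solution has difference
  \<open>D\<close>.\<close>

definition discount :: "real \<Rightarrow> real"
  where "discount D = (B d K 2 D 0 - B d K 1 D 0) / D"

lemma discount_pos: "0 < D \<Longrightarrow> D < d \<Longrightarrow> 0 < discount D"
  using B_2_pos[of D] B_1_nonpos[of D] by (simp add: discount_def)

text \<open>Both Hamiltonians vanish at \<open>d\<close> and are 1-Lipschitz in \<open>D\<close>.
  The bound sends the discount to 0 as \<open>D\<close> tends to \<open>d\<close>, and keeps a loss
  of order \<open>d - D\<close> visible after division by the discount.\<close>

lemma discount_le:
  assumes "0 < D" "D < d" shows "discount D \<le> 2 * (d - D) / D"
  using assms B_1_lipschitz[of D d] B_2_lipschitz[of D d] B_1_at_d B_2_at_d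
  by (auto simp: discount_def intro!: divide_right_mono)

lemma discount_at_right_0:
  assumes "D \<longlonglongrightarrow> d" "\<And>n :: nat. D n < d"
  shows "filterlim (\<lambda>n. discount (D n)) (at_right 0) sequentially"
proof -
  have pos: "\<forall>\<^sub>F n in sequentially. 0 < D n"
    using assms(1) d_gt_1 by (intro order_tendstoD) auto
  have gt: "\<forall>\<^sub>F n in sequentially. 0 < discount (D n)"
    using pos by eventually_elim (simp add: discount_pos assms(2))
  have le: "\<forall>\<^sub>F n in sequentially. discount (D n) \<le> 2 * (d - D n) / D n"
    using pos by eventually_elim (rule discount_le[OF _ assms(2)])
  have "(\<lambda>n. 2 * (d - D n) / D n) \<longlonglongrightarrow> 2 * (d - d) / d"
    using d_gt_1 by (intro tendsto_intros assms(1)) auto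
  then have lim: "(\<lambda>n. 2 * (d - D n) / D n) \<longlonglongrightarrow> 0" by simp
  have "(\<lambda>n. discount (D n)) \<longlonglongrightarrow> 0"
    by (rule tendsto_sandwich[OF eventually_mono[OF gt less_imp_le] le tendsto_const lim])
  then show ?thesis using gt by (rule tendsto_imp_filterlim_at_right)
qed

end

section \<open>Solutions of the discounted system\<close>

locale discounted_system = hamiltonian +
  fixes X Y :: "real \<Rightarrow> real"
  assumes solution: "lam > 0 \<Longrightarrow>
    lam * X lam + B d K 1 (X lam) (Y lam) = 0 \<and> lam * Y lam + B d K 2 (X lam) (Y lam) = 0"
begin

lemma X_eq: "lam > 0 \<Longrightarrow> X lam = - B d K 1 (X lam - Y lam) 0 / lam"
  and Y_eq: "lam > 0 \<Longrightarrow> Y lam = - B d K 2 (X lam - Y lam) 0 / lam"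
  using solution[of lam] B_diff[of "X lam" "Y lam"] by (auto simp: field_simps)

lemma difference_eq:
  assumes "lam > 0"
  shows "lam * (X lam - Y lam) = B d K 2 (X lam - Y lam) 0 - B d K 1 (X lam - Y lam) 0"
  using solution[OF assms] B_diff[of "X lam" "Y lam"] by (simp add: algebra_simps)

text \<open>\<open>lam * D + B d K 1 D 0 - B d K 2 D 0\<close> is strictly increasing in
  \<open>D\<close>.\<close>

lemma difference_unique:
  assumes "lam > 0" "lam * D = B d K 2 D 0 - B d K 1 D 0"
  shows "X lam - Y lam = D"
proof (rule linorder_cases)
  assume "X lam - Y lam < D"
  then show ?thesis
    using difference_eq[OF assms(1)] assms B_1_mono[of "X lam - Y lam" D]
      B_2_antimono[of "X lam - Y lam" D] mult_strict_left_mono[of "X lam - Y lam" D lam]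
    by linarith
next
  assume "D < X lam - Y lam"
  then show ?thesis
    using difference_eq[OF assms(1)] assms B_1_mono[of D "X lam - Y lam"]
      B_2_antimono[of D "X lam - Y lam"] mult_strict_left_mono[of D "X lam - Y lam" lam]
    by linarith
qed

text \<open>For a difference of at least \<open>d\<close>, the right-hand side of
  \<open>difference_eq\<close> would be nonpositive but the left-hand side positive.\<close>

lemma difference_lt:
  assumes "lam > 0" shows "X lam - Y lam < d"
proof (rule ccontr)
  assume "\<not> ?thesis"
  then have "d \<le> X lam - Y lam" by simp
  then have "lam * (X lam - Y lam) \<le> 0" "0 < X lam - Y lam"
    using difference_eq[OF assms] B_1_mono[of d] B_2_antimono[of d] B_1_at_d B_2_at_d d_gt_1
    by fastforce+
  with assms show False by (simp add: mult_le_0_iff)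
qed

lemma X_nonneg: "lam > 0 \<Longrightarrow> 0 \<le> X lam"
  using X_eq[of lam] B_1_nonpos[of "X lam - Y lam"] difference_lt[of lam]
  by (metis divide_nonneg_pos less_imp_le neg_0_le_iff_le)

lemma Y_nonpos: "lam > 0 \<Longrightarrow> Y lam \<le> 0"
  using Y_eq[of lam] B_2_pos[of "X lam - Y lam"] difference_lt[of lam]
  by (metis divide_nonpos_pos less_imp_le neg_le_0_iff_le)

text \<open>The signs of \<open>X lam\<close> and \<open>Y lam\<close> make their difference the sum
  of their absolute values, and this is below \<open>d\<close>.\<close>

lemma bounded_solutions: "bounded {(X lam, Y lam) | lam. lam > 0}"
proof (rule bounded_subset)
  show "bounded ({0..d} \<times> {- d..0})" by (intro bounded_Times bounded_closed_interval)
  show "{(X lam, Y lam) | lam. lam > 0} \<subseteq> {0..d} \<times> {- d..0}"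
    using X_nonneg Y_nonpos difference_lt by fastforce
qed

lemma solution_at_discount:
  assumes "0 < D" "D < d"
  shows "X (discount D) = D / 2 - (B d K 1 D 0 + B d K 2 D 0) / (2 * discount D)"
    and "Y (discount D) = X (discount D) - D"
proof -
  note pos = discount_pos[OF assms]
  have eq: "discount D * D = B d K 2 D 0 - B d K 1 D 0"
    using assms by (simp add: discount_def)
  have diff: "X (discount D) - Y (discount D) = D"
    by (rule difference_unique[OF pos eq])
  then show "Y (discount D) = X (discount D) - D" by simp
  have "X (discount D) = - B d K 1 D 0 / discount D"
    using X_eq[OF pos] unfolding diff .
  \<comment> \<open>Minus the first Hamiltonian is half of the difference
    \<open>discount D * D\<close> minus half of the sum.\<close>
  also have "\<dots> = D / 2 - (B d K 1 D 0 + B d K 2 D 0) / (2 * discount D)"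
    using pos eq by (simp add: field_simps)
  finally show "X (discount D) = D / 2 - (B d K 1 D 0 + B d K 2 D 0) / (2 * discount D)" .
qed

section \<open>Oscillation as \<open>lam\<close> tends to 0\<close>

lemma Liminf_solutions:
  shows "Liminf (at_right 0) (\<lambda>lam. ereal (X lam)) \<le> ereal (d / 2)"
    and "Liminf (at_right 0) (\<lambda>lam. ereal (Y lam)) \<le> ereal (- d / 2)"
proof -
  \<comment> \<open>The exponent \<open>n + K\<close> keeps the balancing control in
    \<open>ctrlA d K\<close>.\<close>
  define D where "D n = balanced ((1 / 4) ^ (n + K))" for n
  have "(\<lambda>n. (1 / 4 :: real) ^ (n + K)) \<longlonglongrightarrow> 0"
    by (intro LIMSEQ_ignore_initial_segment LIMSEQ_power_zero) simp
  then have "D \<longlonglongrightarrow> d - 0 * (1 + d)\<^sup>2 / (2 * gam d - 1 + 2 * 0)"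
    unfolding D_def balanced_def using gam_gt_half by (intro tendsto_intros) auto
  then have D: "D \<longlonglongrightarrow> d" by simp
  have lt: "D n < d" for n
    using gam_gt_half d_gt_1 by (simp add: D_def balanced_def add_pos_pos)
  have "\<forall>\<^sub>F n in sequentially. 0 < D n"
    using D d_gt_1 by (intro order_tendstoD) auto
  then have "\<forall>\<^sub>F n in sequentially.
      X (discount (D n)) \<le> D n / 2 \<and> Y (discount (D n)) \<le> - D n / 2"
  proof (eventually_elim)
    fix n assume pos: "0 < D n"
    have "gam d + (1 / 4) ^ (n + K) \<in> ctrlA d K"
      by (auto simp: ctrlA_def power_divide)
    then have "0 \<le> B d K 1 (D n) 0 + B d K 2 (D n) 0"
      unfolding D_def by (rule B_sum_nonneg_balanced) simp
    then have "0 \<le> (B d K 1 (D n) 0 + B d K 2 (D n) 0) / (2 * discount (D n))"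
      using discount_pos[OF pos lt] by simp
    then show "X (discount (D n)) \<le> D n / 2 \<and> Y (discount (D n)) \<le> - D n / 2"
      using solution_at_discount[OF pos lt] by linarith
  qed
  then have X: "\<forall>\<^sub>F n in sequentially. X (discount (D n)) \<le> D n / 2"
    and Y: "\<forall>\<^sub>F n in sequentially. Y (discount (D n)) \<le> - D n / 2"
    by (simp_all add: eventually_conj_iff)
  note lim = discount_at_right_0[OF D lt]
  show "Liminf (at_right 0) (\<lambda>lam. ereal (X lam)) \<le> ereal (d / 2)"
    using X D by (intro Liminf_le_tendsto_along[OF lim, where g = "\<lambda>n. ereal (D n / 2)"]
      lim_ereal[THEN iffD2] tendsto_intros) auto
  show "Liminf (at_right 0) (\<lambda>lam. ereal (Y lam)) \<le> ereal (- d / 2)"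
    using Y D by (intro Liminf_le_tendsto_along[OF lim, where g = "\<lambda>n. ereal (- D n / 2)"]
      lim_ereal[THEN iffD2] tendsto_intros) auto
qed

lemma Limsup_solutions:
  shows "ereal (d / 2) < Limsup (at_right 0) (\<lambda>lam. ereal (X lam))"
    and "ereal (- d / 2) < Limsup (at_right 0) (\<lambda>lam. ereal (Y lam))"
proof -
  define h :: "nat \<Rightarrow> real" where "h n = (1 / 4) ^ Suc n" for n
  define D where "D n = d - h n * slope" for n
  \<comment> \<open>\<open>B_sum_gap\<close> bounds the sum, and \<open>discount_le\<close> with
    \<open>d - D n = h n * slope\<close> bounds the discount. The factor \<open>h n\<close> cancels
    in the quotient, so the gain \<open>r n\<close> over \<open>D n / 2\<close> keeps the positive
    limit \<open>l\<close>.\<close>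
  define r where "r n = (1 + d - 8 * (h n * slope)) * D n / (4 * slope)" for n
  define l where "l = (1 + d) * d / (4 * slope)"
  have l: "l > 0" using d_gt_1 slope_pos by (simp add: l_def)
  have h_pos: "h n > 0" for n by (simp add: h_def)
  have h: "h \<longlonglongrightarrow> 0"
    unfolding h_def by (rule LIMSEQ_Suc) (rule LIMSEQ_power_zero, simp)
  then have "D \<longlonglongrightarrow> d - 0 * slope" unfolding D_def by (intro tendsto_intros)
  then have D: "D \<longlonglongrightarrow> d" by simp
  have "r \<longlonglongrightarrow> (1 + d - 8 * (0 * slope)) * d / (4 * slope)"
    unfolding r_def using slope_pos by (intro tendsto_intros h D) auto
  then have r: "r \<longlonglongrightarrow> l" by (simp add: l_def)
  have lt: "D n < d" for n using h_pos slope_pos by (simp add: D_def)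
  \<comment> \<open>Together with \<open>0 < D n\<close>, positivity of \<open>r n\<close> records
    that \<open>8 * (h n * slope) < 1 + d\<close>, so that \<open>B_sum_gap\<close> gives a negative
    bound.\<close>
  have "\<forall>\<^sub>F n in sequentially. 0 < D n" "\<forall>\<^sub>F n in sequentially. 0 < r n"
    using order_tendstoD(1)[OF D] order_tendstoD(1)[OF r] d_gt_1 l by auto
  then have "\<forall>\<^sub>F n in sequentially.
      D n / 2 + r n \<le> X (discount (D n)) \<and> - D n / 2 + r n \<le> Y (discount (D n))"
  proof (eventually_elim)
    fix n assume pos: "0 < D n" and rpos: "0 < r n"
    define w where "w = (1 + d - 8 * (h n * slope)) * h n"
    have rw: "r n = w * D n / (4 * (h n * slope))"
      using h_pos[of n] by (simp add: r_def w_def)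
    have "w > 0"
      using rpos pos slope_pos h_pos[of n] 
      by (auto simp: rw zero_less_divide_iff zero_less_mult_iff mult_less_0_iff)
    have "B d K 1 (D n) 0 + B d K 2 (D n) 0 \<le> - w"
      using B_sum_gap[of n] pos unfolding D_def w_def h_def minus_mult_left by blast
    then have "w / (2 * discount (D n)) \<le> - (B d K 1 (D n) 0 + B d K 2 (D n) 0) / (2 * discount (D n))"
      using discount_pos[OF pos lt] by (intro divide_right_mono) auto
    moreover have "r n \<le> w / (2 * discount (D n))"
    proof -
      have "discount (D n) * D n \<le> 2 * (h n * slope)"
        using discount_le[OF pos lt] unfolding pos_le_divide_eq[OF pos] by (simp add: D_def)
      then have "w * (2 * (discount (D n) * D n)) \<le> w * (2 * (2 * (h n * slope)))"
        using \<open>w > 0\<close> by (intro mult_left_mono) simp_all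
      then show ?thesis
        using discount_pos[OF pos lt] h_pos[of n] slope_pos by (simp add: rw field_simps)
    qed
    ultimately show "D n / 2 + r n \<le> X (discount (D n)) \<and> - D n / 2 + r n \<le> Y (discount (D n))"
      using solution_at_discount[OF pos lt] by (simp add: diff_divide_distrib add_divide_distrib)
  qed
  then have X: "\<forall>\<^sub>F n in sequentially. D n / 2 + r n \<le> X (discount (D n))"
    and Y: "\<forall>\<^sub>F n in sequentially. - D n / 2 + r n \<le> Y (discount (D n))"
    by (simp_all add: eventually_conj_iff)
  note lim = discount_at_right_0[OF D lt]
  have "ereal (d / 2 + l) \<le> Limsup (at_right 0) (\<lambda>lam. ereal (X lam))"
    using X D r by (intro Limsup_ge_tendsto_along[OF lim, where g = "\<lambda>n. ereal (D n / 2 + r n)"]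
      lim_ereal[THEN iffD2] tendsto_intros) auto
  then show "ereal (d / 2) < Limsup (at_right 0) (\<lambda>lam. ereal (X lam))"
    by (rule less_le_trans[rotated]) (use l in simp)
  have "ereal (- d / 2 + l) \<le> Limsup (at_right 0) (\<lambda>lam. ereal (Y lam))"
    using Y D r by (intro Limsup_ge_tendsto_along[OF lim, where g = "\<lambda>n. ereal (- D n / 2 + r n)"]
      lim_ereal[THEN iffD2] tendsto_intros) auto
  then show "ereal (- d / 2) < Limsup (at_right 0) (\<lambda>lam. ereal (Y lam))"
    by (rule less_le_trans[rotated]) (use l in simp)
qed

text \<open>A limit of the pairs would make the lower and upper limits of \<open>X\<close> coincide,
  yet \<open>d / 2\<close> separates them.\<close>

lemma no_limit: "\<not> (\<exists>l. ((\<lambda>lam. (X lam, Y lam)) \<longlongrightarrow> l) (at_right 0))"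
proof
  assume "\<exists>l. ((\<lambda>lam. (X lam, Y lam)) \<longlongrightarrow> l) (at_right 0)"
  then obtain l where "((\<lambda>lam. (X lam, Y lam)) \<longlongrightarrow> l) (at_right 0)" ..
  then have "((\<lambda>lam. ereal (X lam)) \<longlongrightarrow> ereal (fst l)) (at_right 0)"
    by (auto dest: tendsto_fst)
  then have "Liminf (at_right 0) (\<lambda>lam. ereal (X lam)) = Limsup (at_right 0) (\<lambda>lam. ereal (X lam))"
    using lim_imp_Liminf[OF trivial_limit_at_right_real] lim_imp_Limsup[OF trivial_limit_at_right_real]
    by metis
  with Liminf_solutions(1) Limsup_solutions(1) show False by simp
qed

end

theorem theorem2:
  fixes d :: real and K :: nat and X Y :: "real \<Rightarrow> real"
  assumes "d > 1" and "K \<ge> 1" and "gam d + 1 / 4 ^ K < 1"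
    and "\<And>lam. lam > 0 \<Longrightarrow>
           lam * X lam + B d K 1 (X lam) (Y lam) = 0 \<and>
           lam * Y lam + B d K 2 (X lam) (Y lam) = 0"
  shows "bounded {(X lam, Y lam) | lam. lam > 0}
    \<and> Liminf (at_right 0) (\<lambda>lam. ereal (X lam)) \<le> ereal (d / 2)
    \<and> ereal (d / 2) < Limsup (at_right 0) (\<lambda>lam. ereal (X lam))
    \<and> Liminf (at_right 0) (\<lambda>lam. ereal (Y lam)) \<le> ereal (- d / 2)
    \<and> ereal (- d / 2) < Limsup (at_right 0) (\<lambda>lam. ereal (Y lam))
    \<and> \<not> (\<exists>l. ((\<lambda>lam. (X lam, Y lam)) \<longlongrightarrow> l) (at_right 0))"
proof -
  interpret discounted_system d K X Y
    using assms by unfold_locales auto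
  show ?thesis
    using bounded_solutions Liminf_solutions Limsup_solutions no_limit by blast
qed

end
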